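(* Let $\Lambda$ be a compact Hausdorff space and let $\lambda \in \Lambda \mapsto \phi_\lambda \in \Gamma(X,\mathbb{R})$ be a convex lagrangian cover of the BB-graph $M \subset X \times Y$, with $\phi_\lambda^* \in \Gamma(Y,\mathbb{R})$ for any $\lambda \in \Lambda$, such that: (a) for any $x \in X$ and for any $y \in Y$ the functions $\Lambda \ni \lambda \mapsto \phi_\lambda(x) \in \mathbb{R}$ and $\Lambda \ni \lambda \mapsto \phi_\lambda^*(y) \in \mathbb{R}$ are continuous; (b) the cover is Fan bi-implicitly convex. Then the function $b : X \times Y \to \mathbb{R}$ defined by $$b(x,y) = \inf\{ \phi_\lambda(x) + \phi_\lambda^*(y) \mid \lambda \in \Lambda \}$$ is a bipotential and $M = M(b)$.
   Context: Setting. $X$ and $Y$ are topological, locally convex, real vector spaces of dual variables with a duality product $\langle \cdot,\cdot\rangle : X \times Y \to \mathbb{R}$. The topologies are compatible with the duality product: any continuous linear functional on $X$ (resp. $Y$) has the form $x \mapsto \langle x,y\rangle$ for some $y \in Y$ (resp. $y \mapsto \langle x,y\rangle$ for some $x \in X$). Put $\bar{\mathbb{R}} = \mathbb{R} \cup \{+\infty\}$. Notation. $\Gamma(X,\mathbb{R})$ (resp. $\Gamma(Y,\mathbb{R})$) is the class of convex lower semicontinuous functions $X \to \mathbb{R}$ (resp. $Y\to\mathbb{R}$). The Fenchel conjugate of $\phi : X \to \bar{\mathbb{R}}$ is $\phi^*(y) = \sup\{\langle x,y\rangle - \phi(x) \mid x \in X\}$, $y\in Y$. The subdifferential of $\phi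 : X \to \bar{\mathbb{R}}$ at a point $x$ with $\phi(x) \in \mathbb{R}$ is $\partial\phi(x) = \{u \in Y \mid \forall z \in X,\ \langle z-x,u\rangle \le \phi(z)-\phi(x)\}$; the subdifferential of a function $Y\to\bar{\mathbb{R}}$ is defined similarly, as a subset of $X$. For a convex lower semicontinuous $\phi$ on $X$, $M(\phi) = \{(x,y) \in X\times Y \mid \phi(x)+\phi^*(y) = \langle x,y\rangle\}$. BB-graph. For $M \subset X\times Y$ let $m(x) = \{y \in Y \mid (x,y)\in M\}$, $m^*(y) = \{x\in X \mid (x,y)\in M\}$, $dom(M) = \{x \mid m(x)\neq\emptyset\}$, $im(M) = \{y \mid m^*(y)\neq\emptyset\}$. A non empty set $M$ is a BB-graph if for all $x \in dom(M)$ and all $y \in im(M)$ the sets $m(x)$ and $m^*(y)$ are convex and closed. Bipotential. A function $b : X\times Y \to \bar{\mathbb{R}}$ is a bipotential if: (i) $b$ is convex and lower semicontinuous in each argument; (ii) $b(x,y)\ge\langle x,y\rangle$ for all $x\in X$, $y\in Y$; (iii) for any $(x,y) \in X\times Y$: $y\in\partial b(\cdot,y)(x) \iff x\in\partial b(x,\cdot)(y) \iff b(x,y)=\langle x,y\rangle$. Its graph is $M(b) = \{(x,y)\in X\times Y \mid b(x,y)=\langle x,y\rangle\}$. Convex lagrangian cover. A convex lagrangian cover of a non empty set $M\subset X\times Y$ is a map $\lambda\in\Lambda\mapsto\phi_\lambda$ with values in the set of lower semicontinuous convex functions on $X$ such that: (i) $\Lambda$ is a non empty compact topological space; (ii) with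 $f(\lambda,x,y)=\phi_\lambda(x)+\phi_\lambda^*(y)$, for any $x \in X$ and any $y\in Y$ the maps $\lambda\mapsto f(\lambda,x,\cdot)$ and $\lambda\mapsto f(\lambda,\cdot,y)$ are lower semicontinuous for pointwise convergence, i.e. for all $(x,y)\in X\times Y$ the function $\lambda\mapsto f(\lambda,x,y)$ is lower semicontinuous on $\Lambda$; (iii) $M=\bigcup_{\lambda\in\Lambda}M(\phi_\lambda)$. Convexity in the sense of Fan. For arbitrary non empty sets $A,B$, a function $F:A\times B\to\mathbb{R}$ is convex on $A$ in the sense of Fan if for any $a_1,a_2\in A$ and any $\alpha,\beta\in[0,1]$ with $\alpha+\beta=1$ there exists $a\in A$ such that for all $t\in B$: $F(a,t)\le\alpha F(a_1,t)+\beta F(a_2,t)$. Fan bi-implicitly convex cover. Define $g:X\times\Lambda\times X\to\mathbb{R}$, $g(x,\lambda,z)=\phi_\lambda(x)-\phi_\lambda(z)$, and $h:Y\times\Lambda\times Y\to\mathbb{R}$, $h(y,\lambda,u)=\phi_\lambda^*(y)-\phi_\lambda^*(u)$. The cover is Fan bi-implicitly convex if for any $x\in X$ and $y\in Y$ the function $g(x,\cdot,\cdot):\Lambda\times X\to\mathbb{R}$ and the function $h(y,\cdot,\cdot):\Lambda\times Y\to\mathbb{R}$ are convex on $\Lambda$ in the sense of Fan. *)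

theory Defs
  imports "HOL-Analysis.Analysis"
begin

section \<open>Locally convex spaces in duality\<close>

text \<open>Topological real vector spaces whose points have neighbourhood bases of convex open sets.
  No separation axiom is imposed.\<close>

class locally_convex_space = real_vector + topological_ab_group_add +
  assumes tendsto_scaleR_Pair: "LIM p (nhds r \<times>\<^sub>F nhds a). fst p *\<^sub>R snd p :> nhds (r *\<^sub>R a)"
    and locally_convex:
      "open U \<Longrightarrow> x \<in> U \<Longrightarrow>
        \<exists>V. open V \<and> x \<in> V \<and> V \<subseteq> U \<and>
            (\<forall>v\<in>V. \<forall>w\<in>V. \<forall>s\<ge>0. \<forall>t\<ge>0. s + t = 1 \<longrightarrow> s *\<^sub>R v + t *\<^sub>R w \<in> V)"

text \<open>Compatibility is required in the form that every continuous linear functional is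
  represented by the pairing; neither continuity of the functionals given by the pairing
  nor non-degeneracy is assumed.\<close>

definition compatible_duality ::
    "('x::locally_convex_space \<Rightarrow> 'y::locally_convex_space \<Rightarrow> real) \<Rightarrow> bool" where
  "compatible_duality pair \<longleftrightarrow>
     bilinear pair \<and>
     (\<forall>f::'x \<Rightarrow> real. linear f \<and> continuous_on UNIV f \<longrightarrow> (\<exists>y. \<forall>x. f x = pair x y)) \<and>
     (\<forall>f::'y \<Rightarrow> real. linear f \<and> continuous_on UNIV f \<longrightarrow> (\<exists>x. \<forall>y. f y = pair x y))"


section \<open>Convex lower semicontinuous functions\<close>

text \<open>Functions with values in \<open>\<real> \<union> {+\<infinity>}\<close> are represented as \<^typ>\<open>ereal\<close>-valued functions that
  avoid \<open>-\<infinity>\<close>; on such values the convention \<open>0 * \<infinity> = 0\<close> of \<^typ>\<open>ereal\<close> is harmless in the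
  convexity inequality.\<close>

definition lsc :: "('a::topological_space \<Rightarrow> ereal) \<Rightarrow> bool" where
  "lsc f \<longleftrightarrow> (\<forall>c. open {x. c < f x})"

definition ereal_convex :: "('a::real_vector \<Rightarrow> ereal) \<Rightarrow> bool" where
  "ereal_convex f \<longleftrightarrow>
     (\<forall>x y. \<forall>s\<ge>0. \<forall>t\<ge>0. s + t = 1 \<longrightarrow>
        f (s *\<^sub>R x + t *\<^sub>R y) \<le> ereal s * f x + ereal t * f y)"

definition convex_lsc :: "('a::locally_convex_space \<Rightarrow> ereal) \<Rightarrow> bool" where
  "convex_lsc f \<longleftrightarrow> (\<forall>x. f x \<noteq> -\<infinity>) \<and> ereal_convex f \<and> lsc f"

text \<open>The class \<open>\<Gamma>(X, \<real>)\<close> of finite-valued convex lower semicontinuous functions.\<close>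

definition Gamma_fin :: "('a::locally_convex_space \<Rightarrow> ereal) set" where
  "Gamma_fin = {f. (\<forall>x. \<bar>f x\<bar> \<noteq> \<infinity>) \<and> convex_lsc f}"

definition fenchel_conj :: "('x \<Rightarrow> 'y \<Rightarrow> real) \<Rightarrow> ('x \<Rightarrow> ereal) \<Rightarrow> 'y \<Rightarrow> ereal" where
  "fenchel_conj pair \<phi> y = (SUP x. ereal (pair x y) - \<phi> x)"

text \<open>For a function on \<open>Y\<close>, the same definition is used with the flipped pairing
  \<open>\<lambda>y x. pair x y\<close>. The subdifferential is empty at points where \<open>\<phi>\<close> is not finite.\<close>

definition subdiff :: "('x::real_vector \<Rightarrow> 'y \<Rightarrow> real) \<Rightarrow> ('x \<Rightarrow> ereal) \<Rightarrow> 'x \<Rightarrow> 'y set" where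
  "subdiff pair \<phi> x = {u. \<bar>\<phi> x\<bar> \<noteq> \<infinity> \<and> (\<forall>z. ereal (pair (z - x) u) \<le> \<phi> z - \<phi> x)}"

definition fenchel_graph :: "('x \<Rightarrow> 'y \<Rightarrow> real) \<Rightarrow> ('x \<Rightarrow> ereal) \<Rightarrow> ('x \<times> 'y) set" where
  "fenchel_graph pair \<phi> = {(x, y). \<phi> x + fenchel_conj pair \<phi> y = ereal (pair x y)}"


section \<open>BB-graphs and bipotentials\<close>

text \<open>The sections \<open>m(x)\<close> and \<open>m\<^sup>*(y)\<close> are \<open>M `` {x}\<close> and \<open>M\<inverse> `` {y}\<close>.\<close>

definition BB_graph :: "('x::locally_convex_space \<times> 'y::locally_convex_space) set \<Rightarrow> bool" where
  "BB_graph M \<longleftrightarrow> M \<noteq> {} \<and>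
     (\<forall>x\<in>Domain M. convex (M `` {x}) \<and> closed (M `` {x})) \<and>
     (\<forall>y\<in>Range M. convex (M\<inverse> `` {y}) \<and> closed (M\<inverse> `` {y}))"

definition bipotential ::
    "('x::locally_convex_space \<Rightarrow> 'y::locally_convex_space \<Rightarrow> real) \<Rightarrow> ('x \<Rightarrow> 'y \<Rightarrow> ereal) \<Rightarrow> bool" where
  "bipotential pair b \<longleftrightarrow>
     (\<forall>y. convex_lsc (\<lambda>x. b x y)) \<and> (\<forall>x. convex_lsc (\<lambda>y. b x y)) \<and>
     (\<forall>x y. b x y \<ge> ereal (pair x y)) \<and>
     (\<forall>x y. (y \<in> subdiff pair (\<lambda>z. b z y) x \<longleftrightarrow> x \<in> subdiff (\<lambda>u z. pair z u) (\<lambda>u. b x u) y) \<and>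
            (x \<in> subdiff (\<lambda>u z. pair z u) (\<lambda>u. b x u) y \<longleftrightarrow> b x y = ereal (pair x y)))"

definition bipotential_graph :: "('x \<Rightarrow> 'y \<Rightarrow> real) \<Rightarrow> ('x \<Rightarrow> 'y \<Rightarrow> ereal) \<Rightarrow> ('x \<times> 'y) set" where
  "bipotential_graph pair b = {(x, y). b x y = ereal (pair x y)}"


section \<open>Convex lagrangian covers\<close>

text \<open>The index space \<open>\<Lambda>\<close> is the whole type \<open>'l\<close>, hence automatically non-empty.\<close>

definition convex_lagrangian_cover ::
    "('x::locally_convex_space \<Rightarrow> 'y::locally_convex_space \<Rightarrow> real) \<Rightarrow>
     ('l::topological_space \<Rightarrow> 'x \<Rightarrow> ereal) \<Rightarrow> ('x \<times> 'y) set \<Rightarrow> bool" where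
  "convex_lagrangian_cover pair \<phi> M \<longleftrightarrow> M \<noteq> {} \<and>
     (\<forall>l. convex_lsc (\<phi> l)) \<and>
     compact (UNIV :: 'l set) \<and>
     (\<forall>x y. lsc (\<lambda>l. \<phi> l x + fenchel_conj pair (\<phi> l) y)) \<and>
     M = (\<Union>l. fenchel_graph pair (\<phi> l))"

text \<open>Convexity in the sense of Fan, in the first argument, for functions whose values are finite;
  \<^typ>\<open>ereal\<close> is used only so that it applies directly to differences of
  \<^typ>\<open>ereal\<close>-valued functions.\<close>

definition fan_convex :: "('a \<Rightarrow> 'b \<Rightarrow> ereal) \<Rightarrow> bool" where
  "fan_convex F \<longleftrightarrow>
     (\<forall>a1 a2. \<forall>\<alpha>\<in>{0..1}. \<forall>\<beta>\<in>{0..1}. \<alpha> + \<beta> = 1 \<longrightarrow>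
        (\<exists>a. \<forall>t. F a t \<le> ereal \<alpha> * F a1 t + ereal \<beta> * F a2 t))"

definition fan_bi_implicitly_convex ::
    "('x \<Rightarrow> 'y \<Rightarrow> real) \<Rightarrow> ('l \<Rightarrow> 'x \<Rightarrow> ereal) \<Rightarrow> bool" where
  "fan_bi_implicitly_convex pair \<phi> \<longleftrightarrow>
     (\<forall>x. fan_convex (\<lambda>l z. \<phi> l x - \<phi> l z)) \<and>
     (\<forall>y. fan_convex (\<lambda>l u. fenchel_conj pair (\<phi> l) y - fenchel_conj pair (\<phi> l) u))"

end

theory Submission
  imports Defs
begin

text \<open>Fan convexity of \<open>l \<mapsto> \<phi>\<^sub>l\<^sup>*(y) - \<phi>\<^sub>l\<^sup>*(u)\<close>, inserted into
  \<open>\<phi>\<^sub>l(x) = sup\<^bsub>u\<^esub> pair x u - \<phi>\<^sub>l\<^sup>*(u)\<close>, makes \<open>b (_, y)\<close> convex. A minimax theorem then exchanges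
  the infimum over \<open>l\<close> with this supremum and exhibits \<open>b (_, y)\<close> as a supremum of continuous
  affine functions, hence as lower semicontinuous. If \<open>y\<close> is a subgradient of \<open>b (_, y)\<close> at \<open>x\<close>, then
  \<open>x\<close> minimizes \<open>b (_, y) - pair _ y\<close>, whose infimum is \<open>0\<close>. The argument is symmetric in the two
  variables, and \<open>M = M(b)\<close> because the infimum over the compact index space is attained.\<close>

section \<open>Sublinear functionals and the Hahn--Banach theorem\<close>

definition sublinear :: "('a::real_vector \<Rightarrow> real) \<Rightarrow> bool" where
  "sublinear p \<longleftrightarrow> (\<forall>x y. p (x + y) \<le> p x + p y) \<and> (\<forall>t>0. \<forall>x. p (t *\<^sub>R x) = t * p x)"

lemma sublinear_zero: "sublinear p \<Longrightarrow> p 0 = 0"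
  unfolding sublinear_def by (metis less_numeral_extra(1) mult_cancel_right1 numeral_eq_one_iff scaleR_zero_right semiring_norm(85) zero_less_numeral)

lemma sublinear_scale_nonneg: "sublinear p \<Longrightarrow> 0 \<le> t \<Longrightarrow> p (t *\<^sub>R x) = t * p x"
  using sublinear_zero[of p] unfolding sublinear_def by (cases "t = 0") auto

text \<open>Sublinear functionals are built below as infima over such sets \<open>S v\<close>. The
  infima are finite: for \<open>b \<in> S (- v)\<close>, \<open>add\<close> and
  \<open>nonneg\<close> make \<open>- b\<close> a lower bound of \<open>S v\<close>.\<close>

lemma sublinear_Inf:
  fixes S :: "'a::real_vector \<Rightarrow> real set"
  assumes ne: "\<And>v. S v \<noteq> {}"
    and nonneg: "\<And>a. a \<in> S 0 \<Longrightarrow> 0 \<le> a"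
    and add: "\<And>v w a b. a \<in> S v \<Longrightarrow> b \<in> S w \<Longrightarrow> \<exists>c\<in>S (v + w). c \<le> a + b"
    and scale: "\<And>v a t. a \<in> S v \<Longrightarrow> 0 < t \<Longrightarrow> t * a \<in> S (t *\<^sub>R v)"
  shows "sublinear (\<lambda>v. Inf (S v)) \<and> (\<forall>v. \<forall>a\<in>S v. Inf (S v) \<le> a)"
proof -
  have bdd: "bdd_below (S v)" for v
  proof -
    obtain b where b: "b \<in> S (- v)" using ne by blast
    have "- b \<le> a" if "a \<in> S v" for a
      using add[OF that b] nonneg by fastforce
    then show ?thesis by (rule bdd_belowI)
  qed
  have lower: "Inf (S v) \<le> a" if "a \<in> S v" for a v
    using that bdd by (rule cInf_lower)
  have add_le: "Inf (S (v + w)) \<le> Inf (S v) + Inf (S w)" for v w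
  proof -
    have "Inf (S (v + w)) \<le> a + b" if "a \<in> S v" "b \<in> S w" for a b
      using add[OF that] lower by force
    then have "Inf (S (v + w)) - b \<le> Inf (S v)" if "b \<in> S w" for b
      using that by (intro cInf_greatest[OF ne]) (auto simp: diff_le_eq)
    then have "Inf (S (v + w)) - Inf (S v) \<le> Inf (S w)"
      by (intro cInf_greatest[OF ne]) (auto simp: algebra_simps)
    then show ?thesis by simp
  qed
  have scale_le: "Inf (S (t *\<^sub>R v)) \<le> t * Inf (S v)" if t: "0 < t" for t v
  proof -
    have "Inf (S (t *\<^sub>R v)) / t \<le> a" if "a \<in> S v" for a
      using lower[OF scale[OF that t]] t by (simp add: field_simps)
    then have "Inf (S (t *\<^sub>R v)) / t \<le> Inf (S v)"
      by (rule cInf_greatest[OF ne])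
    then show ?thesis using t by (simp add: field_simps)
  qed
  have "Inf (S (t *\<^sub>R v)) = t * Inf (S v)" if t: "0 < t" for t v
  proof (rule antisym[OF scale_le[OF t]])
    have "Inf (S ((1 / t) *\<^sub>R (t *\<^sub>R v))) \<le> (1 / t) * Inf (S (t *\<^sub>R v))"
      using t by (intro scale_le) simp
    then show "t * Inf (S v) \<le> Inf (S (t *\<^sub>R v))"
      using t by (simp add: field_simps)
  qed
  with add_le lower show ?thesis
    unfolding sublinear_def by blast
qed

text \<open>A minimal sublinear functional \<open>q\<close> is linear, since it is not improved by
  \<open>v \<mapsto> inf\<^bsub>t \<ge> 0\<^esub> q (v + t a) - t q a\<close>.\<close>

lemma minimal_sublinear_imp_linear:
  assumes q: "sublinear q" and min: "\<And>r. sublinear r \<Longrightarrow> r \<le> q \<Longrightarrow> r = q"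
  shows "linear q"
proof -
  note q' = q[unfolded sublinear_def]
  have super: "q v + q a \<le> q (v + a)" for v a
  proof -
    define S where "S v = {q (v + t *\<^sub>R a) - t * q a |t. 0 \<le> t}" for v
    define r where "r v = Inf (S v)" for v
    have "sublinear r \<and> (\<forall>v. \<forall>x\<in>S v. r v \<le> x)"
      unfolding r_def
    proof (rule sublinear_Inf)
      show "S v \<noteq> {}" for v unfolding S_def by auto
      show "0 \<le> a" if "a \<in> S 0" for a
        using that unfolding S_def by (auto simp: sublinear_scale_nonneg[OF q])
      show "\<exists>z\<in>S (v + w). z \<le> x + y" if "x \<in> S v" "y \<in> S w" for v w x y
      proof -
        from that obtain s t where st: "0 \<le> s" "0 \<le> t"
          and xy: "x = q (v + s *\<^sub>R a) - s * q a" "y = q (w + t *\<^sub>R a) - t * q a"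
          unfolding S_def by auto
        have eq: "v + w + (s + t) *\<^sub>R a = (v + s *\<^sub>R a) + (w + t *\<^sub>R a)"
          by (simp add: algebra_simps)
        have "q (v + w + (s + t) *\<^sub>R a) - (s + t) * q a \<le> x + y"
          unfolding eq xy using q'[THEN conjunct1, rule_format, of "v + s *\<^sub>R a" "w + t *\<^sub>R a"]
          by (simp add: distrib_right)
        moreover have "q (v + w + (s + t) *\<^sub>R a) - (s + t) * q a \<in> S (v + w)"
          unfolding S_def using st by (metis (mono_tags, lifting) add_nonneg_nonneg mem_Collect_eq)
        ultimately show ?thesis by blast
      qed
      show "t * x \<in> S (t *\<^sub>R v)" if "x \<in> S v" "0 < t" for v x t
      proof -
        from that obtain s where s: "0 \<le> s" "x = q (v + s *\<^sub>R a) - s * q a"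
          unfolding S_def by auto
        have "t * x = q (t *\<^sub>R v + (t * s) *\<^sub>R a) - (t * s) * q a"
          using q' \<open>0 < t\<close> s(2) by (metis (no_types, opaque_lifting) mult.assoc
              right_diff_distrib scaleR_add_right scaleR_scaleR)
        then show ?thesis unfolding S_def using s that
          by (metis (mono_tags, lifting) mem_Collect_eq less_imp_le mult_nonneg_nonneg)
      qed
    qed
    then have S: "sublinear r" "\<And>x w. x \<in> S w \<Longrightarrow> r w \<le> x" by auto
    \<comment> \<open>The member with \<open>t = 0\<close> gives \<open>r \<le> q\<close>, so
      \<open>r = q\<close> by minimality; the member with \<open>t = 1\<close> then says
      \<open>q v \<le> q (v + a) - q a\<close>.\<close>
    have "r w \<le> q w" for w
      using S(2)[of "q w" w] unfolding S_def by (force intro: exI[of _ 0])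
    then have "r = q" using min S(1) by (simp add: le_fun_def)
    have "q (v + 1 *\<^sub>R a) - 1 * q a \<in> S v"
      unfolding S_def using zero_le_one by blast
    from S(2)[OF this] show ?thesis unfolding \<open>r = q\<close> by simp
  qed
  have addq: "q (v + a) = q v + q a" for v a
    using super q' by (simp add: antisym)
  have neg: "q (- v) = - q v" for v
    using addq[of v "- v"] sublinear_zero[OF q] by simp
  have "q (t *\<^sub>R v) = t * q v" for t v
  proof (cases "0 \<le> t")
    case True
    then show ?thesis by (rule sublinear_scale_nonneg[OF q])
  next
    case False
    then show ?thesis using sublinear_scale_nonneg[OF q, of "- t" v] neg[of "t *\<^sub>R v"] by simp
  qed
  with addq show ?thesis by (intro linearI) auto
qed

text \<open>Zorn's lemma yields a minimal sublinear functional below \<open>p\<close>, and minimal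
  ones are linear. A nonempty chain is bounded by its pointwise infimum, which is subadditive
  because the smaller of two members can replace both.\<close>

theorem hahn_banach_sublinear:
  assumes p: "sublinear p"
  obtains h where "linear h" "\<And>x. h x \<le> p x"
proof -
  define A where "A = {q. sublinear q \<and> q \<le> p}"
  \<comment> \<open>The order is reversed, since Zorn's lemma produces maximal elements and a
    minimal functional is wanted.\<close>
  define P where "P = (\<lambda>q r :: 'a \<Rightarrow> real. r \<le> q)"
  have "\<exists>m\<in>A. \<forall>q\<in>A. P m q \<longrightarrow> q = m"
  proof (rule predicate_Zorn)
    show "partial_order_on A (relation_of P A)"
      by (rule partial_order_on_relation_ofI) (auto simp: P_def)
  next
    fix C assume "C \<in> Chains (relation_of P A)"
    then have CA: "C \<subseteq> A" and chain: "\<And>q r. q \<in> C \<Longrightarrow> r \<in> C \<Longrightarrow> q \<le> r \<or> r \<le> q"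
      unfolding Chains_def relation_of_def P_def by auto
    show "\<exists>u\<in>A. \<forall>q\<in>C. P q u"
    proof (cases "C = {}")
      case True
      then show ?thesis using p by (auto simp: A_def)
    next
      case False
      define S where "S v = (\<lambda>q. q v) ` C" for v
      define u where "u v = Inf (S v)" for v
      have "sublinear u \<and> (\<forall>v. \<forall>x\<in>S v. u v \<le> x)"
        unfolding u_def
      proof (rule sublinear_Inf)
        show "S v \<noteq> {}" for v unfolding S_def using False by simp
        show "0 \<le> a" if "a \<in> S 0" for a
          using that CA sublinear_zero unfolding S_def A_def by fastforce
        show "\<exists>z\<in>S (v + w). z \<le> x + y" if xy: "x \<in> S v" "y \<in> S w" for v w x y
        proof -
          from xy obtain q r where qr: "q \<in> C" "r \<in> C" "x = q v" "y = r w"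
            unfolding S_def by auto
          then obtain k where k: "k \<in> C" "k \<le> q" "k \<le> r" using chain by blast
          have "k (v + w) \<le> k v + k w"
            using k(1) CA unfolding A_def sublinear_def by auto
          also have "\<dots> \<le> x + y" using k qr by (auto simp: le_fun_def intro: add_mono)
          finally show ?thesis using k(1) unfolding S_def by blast
        qed
        show "t * x \<in> S (t *\<^sub>R v)" if "x \<in> S v" "0 < t" for v x t
        proof -
          from that obtain q where q: "q \<in> C" "x = q v" unfolding S_def by auto
          then have "t * x = q (t *\<^sub>R v)"
            using CA that(2) unfolding A_def sublinear_def by auto
          then show ?thesis using q(1) unfolding S_def by blast
        qed
      qed
      then have S: "sublinear u" "\<And>x w. x \<in> S w \<Longrightarrow> u w \<le> x" by auto
      have "u \<le> q" if "q \<in> C" for q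
        using S(2) that unfolding S_def le_fun_def by blast
      moreover from this have "u \<le> p"
        using False CA unfolding A_def by (metis (mono_tags, lifting) equals0I mem_Collect_eq order_trans subsetD)
      ultimately show ?thesis using S(1) unfolding A_def P_def by blast
    qed
  qed
  then obtain m where m: "sublinear m" "m \<le> p"
    and min: "\<And>q. sublinear q \<Longrightarrow> q \<le> p \<Longrightarrow> q \<le> m \<Longrightarrow> q = m"
    unfolding A_def P_def by blast
  have "linear m"
    using m(1) by (rule minimal_sublinear_imp_linear) (use min m(2) in \<open>blast intro: order_trans\<close>)
  with m(2) that show ?thesis by (simp add: le_fun_def)
qed


section \<open>Continuous affine minorants\<close>

lemma tendsto_scaleR_left_lcs:
  fixes a :: "'a::locally_convex_space"
  shows "((\<lambda>x. r *\<^sub>R x) \<longlongrightarrow> r *\<^sub>R a) (nhds a)"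
  using filterlim_compose[OF tendsto_scaleR_Pair filterlim_Pair[OF tendsto_const filterlim_ident], of r a]
  by simp

text \<open>By symmetry of \<open>V\<close> the upper bound also bounds
  \<open>\<bar>h v\<bar>\<close>, and a linear functional that is bounded on a neighbourhood of 0 is
  continuous.\<close>

lemma linear_bounded_above_imp_continuous:
  fixes h :: "'a::locally_convex_space \<Rightarrow> real"
  assumes h: "linear h" and V: "open V" "0 \<in> V" and sym: "\<And>v. v \<in> V \<Longrightarrow> - v \<in> V"
    and bound: "\<And>v. v \<in> V \<Longrightarrow> h v \<le> B"
  shows "continuous_on UNIV h"
proof -
  have abs: "\<bar>h v\<bar> \<le> B" if "v \<in> V" for v
    using bound[OF that] bound[OF sym[OF that]] linear_neg[OF h, of v] by simp
  have "0 \<le> B" using abs[OF V(2)] by linarith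
  have "(h \<longlongrightarrow> h a) (nhds a)" for a
  proof (rule tendstoI)
    fix e :: real assume e: "0 < e"
    \<comment> \<open>Once \<open>r *\<^sub>R (x - a)\<close> lies in \<open>V\<close>, the
      difference \<open>\<bar>h x - h a\<bar>\<close> is at most \<open>B / r < e\<close>. The
      summand 1 keeps \<open>r\<close> positive when \<open>B = 0\<close>.\<close>
    define r where "r = (B + 1) / e"
    have r: "0 < r" unfolding r_def using e \<open>0 \<le> B\<close> by simp
    have "((\<lambda>x. x - a) \<longlongrightarrow> a - a) (nhds a)"
      by (rule tendsto_diff[OF filterlim_ident tendsto_const])
    then have "((\<lambda>x. r *\<^sub>R (x - a)) \<longlongrightarrow> r *\<^sub>R (0::'a)) (nhds a)"
      using filterlim_compose[OF tendsto_scaleR_left_lcs[of r 0]] by simp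
    then have "\<forall>\<^sub>F x in nhds a. r *\<^sub>R (x - a) \<in> V"
      using V by (auto dest!: topological_tendstoD)
    then show "\<forall>\<^sub>F x in nhds a. dist (h x) (h a) < e"
    proof eventually_elim
      case (elim x)
      have "r * \<bar>h x - h a\<bar> \<le> B"
        using abs[OF elim] r by (simp add: linear_cmul[OF h] linear_diff[OF h] abs_mult)
      also have "\<dots> < r * e" unfolding r_def using e by simp
      finally show ?case using r by (simp add: dist_real_def)
    qed
  qed
  then show ?thesis
    unfolding continuous_on_def by (blast intro: tendsto_mono[OF at_within_le_nhds])
qed

text \<open>Intersect a convex neighbourhood with its reflection, which is open because negation is
  continuous.\<close>

lemma symmetric_convex_nhd:
  fixes U :: "'a::locally_convex_space set"
  assumes "open U" "0 \<in> U"
  obtains V where "open V" "0 \<in> V" "V \<subseteq> U" "convex V" "\<And>v. v \<in> V \<Longrightarrow> - v \<in> V"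
proof -
  obtain W where W: "open W" "0 \<in> W" "W \<subseteq> U" "convex W"
    using locally_convex[OF assms] unfolding convex_def by blast
  have op: "open (uminus ` W)"
  proof -
    have "uminus ` W = uminus -` W" by (auto intro: rev_image_eqI)
    moreover have "continuous_on UNIV (uminus :: 'a \<Rightarrow> 'a)"
      by (intro continuous_on_minus continuous_on_id)
    ultimately show ?thesis using open_vimage W(1) by metis
  qed
  show ?thesis
  proof (rule that[of "W \<inter> uminus ` W"])
    show "convex (W \<inter> uminus ` W)"
      using W(4) by (intro convex_Int convex_negations)
  qed (use W op in \<open>auto intro: rev_image_eqI\<close>)
qed

text \<open>The minorant comes from the sublinear functional whose value at \<open>v\<close> is the infimum of
  \<open>t (f (a + z) - c) + s (f a - c)\<close> over all decompositions \<open>v = t z + s u\<close> with \<open>s, t \<ge> 0\<close> and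
  \<open>u\<close> in a symmetric neighbourhood of \<open>0\<close> on which \<open>f (a + _)\<close> exceeds \<open>c\<close>. The second term
  forces continuity.\<close>

lemma convex_lsc_affine_minorant:
  fixes f :: "'a::locally_convex_space \<Rightarrow> real"
  assumes f: "convex_on UNIV f" and lsc: "open {x. c < f x}" and c: "c < f a"
  obtains h where "linear h" "continuous_on UNIV h" "\<And>x. c + h (x - a) \<le> f x"
proof -
  have fcv: "f (s *\<^sub>R x + t *\<^sub>R y) \<le> s * f x + t * f y" if "0 \<le> s" "0 \<le> t" "s + t = 1" for s t x y
    using f that unfolding convex_on_def by blast
  define U where "U = (\<lambda>v. a + v) -` {x. c < f x}"
  have "open U"
    unfolding U_def by (rule open_vimage[OF lsc]) (intro continuous_intros)
  then obtain V where V: "open V" "0 \<in> V" "V \<subseteq> U" "convex V" and sym: "\<And>v. v \<in> V \<Longrightarrow> - v \<in> V"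
    using symmetric_convex_nhd[of U] c unfolding U_def by auto
  define K where "K = f a - c"
  have K: "0 < K" using c by (simp add: K_def)
  define S where "S v = {t * (f (a + z) - c) + s * K |t z s u.
    0 \<le> t \<and> 0 \<le> s \<and> u \<in> V \<and> v = t *\<^sub>R z + s *\<^sub>R u}" for v
  have SI: "t * (f (a + z) - c) + s * K \<in> S (t *\<^sub>R z + s *\<^sub>R u)"
    if "0 \<le> t" "0 \<le> s" "u \<in> V" for t z s u
    unfolding S_def using that by blast
  define p where "p v = Inf (S v)" for v
  have "sublinear p \<and> (\<forall>v. \<forall>x\<in>S v. p v \<le> x)"
    unfolding p_def
  proof (rule sublinear_Inf)
    show "S v \<noteq> {}" for v using SI[of 1 0 0 v] V(2) by auto
  next
    fix x assume "x \<in> S 0"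
    then obtain t z s u where ts: "0 \<le> t" "0 \<le> s" and u: "u \<in> V" and zu: "t *\<^sub>R z + s *\<^sub>R u = 0"
      and x: "x = t * (f (a + z) - c) + s * K"
      unfolding S_def by auto
    show "0 \<le> x"
    \<comment> \<open>If \<open>s \<le> t\<close> and \<open>t > 0\<close>, then
      \<open>z = - (s / t) u\<close> is a convex combination of \<open>- u\<close> and 0, so it
      stays in \<open>V\<close> and both summands of \<open>x\<close> are nonnegative.\<close>
    proof (cases "s \<le> t")
      case True
      show ?thesis
      proof (cases "t = 0")
        case True
        then show ?thesis using x ts K by simp
      next
        case False
        then have t: "0 < t" using ts by simp
        have "(1 / t) *\<^sub>R (t *\<^sub>R z + s *\<^sub>R u) = 0" using zu by simp
        then have "z + (s / t) *\<^sub>R u = 0" using t by (simp add: scaleR_add_right)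
        then have "z = (s / t) *\<^sub>R (- u) + (1 - s / t) *\<^sub>R 0"
          by (simp add: eq_neg_iff_add_eq_0)
        moreover have "(s / t) *\<^sub>R (- u) + (1 - s / t) *\<^sub>R 0 \<in> V"
          by (rule convexD[OF V(4) sym[OF u] V(2)]) (use t ts True in auto)
        ultimately have "c < f (a + z)" using V(3) unfolding U_def by auto
        then show ?thesis unfolding x using ts K by simp
      qed
    next
      case False
      then have s: "0 < s" using ts by simp
      have "(1 / s) *\<^sub>R (t *\<^sub>R z + s *\<^sub>R u) = 0" using zu by simp
      then have "(t / s) *\<^sub>R z + u = 0" using s by (simp add: scaleR_add_right)
      \<comment> \<open>Now \<open>a - u\<close> lies on the segment from \<open>a\<close> to
        \<open>a + z\<close>. As \<open>f (a - u) > c\<close>, convexity bounds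
        \<open>f (a + z)\<close> from below well enough to give \<open>x > t * K\<close>.\<close>
      then have "- u = (t / s) *\<^sub>R z" by (simp add: neg_eq_iff_add_eq_0 add.commute)
      moreover have "c < f (a + - u)" using sym[OF u] V(3) unfolding U_def by auto
      moreover have "(1 - t / s) *\<^sub>R a + (t / s) *\<^sub>R (a + z) = a + (t / s) *\<^sub>R z"
        by (simp add: algebra_simps)
      moreover have "f ((1 - t / s) *\<^sub>R a + (t / s) *\<^sub>R (a + z)) \<le> (1 - t / s) * f a + (t / s) * f (a + z)"
        by (rule fcv) (use s ts False in auto)
      ultimately have "c < (1 - t / s) * f a + (t / s) * f (a + z)" by simp
      then have "s * c < s * ((1 - t / s) * f a + (t / s) * f (a + z))" using s by simp
      also have "\<dots> = (s - t) * f a + t * f (a + z)" using s by (simp add: field_simps)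
      finally have "0 < t * (f (a + z) - c) + s * K - t * K"
        unfolding K_def by (simp add: algebra_simps)
      then show ?thesis unfolding x using ts K by (smt (verit) mult_nonneg_nonneg)
    qed
  next
    fix v w x y assume "x \<in> S v" "y \<in> S w"
    then obtain t z s u t' z' s' u' where ts: "0 \<le> t" "0 \<le> s" "0 \<le> t'" "0 \<le> s'"
      and u: "u \<in> V" "u' \<in> V" and vw: "v = t *\<^sub>R z + s *\<^sub>R u" "w = t' *\<^sub>R z' + s' *\<^sub>R u'"
      and xy: "x = t * (f (a + z) - c) + s * K" "y = t' * (f (a + z') - c) + s' * K"
      unfolding S_def mem_Collect_eq by metis
    \<comment> \<open>The two decompositions are merged: weighted means replace \<open>z, z'\<close>
      by convexity of \<open>f\<close>, and \<open>u, u'\<close> by convexity of \<open>V\<close>.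
      When the weights sum to 0, any point serves.\<close>
    obtain z'' where z'': "t *\<^sub>R z + t' *\<^sub>R z' = (t + t') *\<^sub>R z''"
      "(t + t') * f (a + z'') \<le> t * f (a + z) + t' * f (a + z')"
    proof (cases "t + t' = 0")
      case True
      then have "t = 0" "t' = 0" using ts by auto
      then show ?thesis using that by simp
    next
      case False
      then have T: "0 < t + t'" using ts by simp
      let ?z = "(t / (t + t')) *\<^sub>R z + (t' / (t + t')) *\<^sub>R z'"
      have one: "t / (t + t') + t' / (t + t') = 1" using T by (simp flip: add_divide_distrib)
      have "a + ?z = (t / (t + t')) *\<^sub>R (a + z) + (t' / (t + t')) *\<^sub>R (a + z')"
        using arg_cong[OF one, of "\<lambda>k. k *\<^sub>R a"] by (simp add: algebra_simps)
      then have "f (a + ?z) \<le> (t / (t + t')) * f (a + z) + (t' / (t + t')) * f (a + z')"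
        using fcv[OF _ _ one] ts by simp
      then have "(t + t') * f (a + ?z) \<le> (t + t') * ((t / (t + t')) * f (a + z) + (t' / (t + t')) * f (a + z'))"
        using T by simp
      also have "\<dots> = t * f (a + z) + t' * f (a + z')" using T by (simp add: distrib_left)
      finally show ?thesis using that[of ?z] T by (simp add: scaleR_add_right)
    qed
    obtain u'' where u'': "u'' \<in> V" "s *\<^sub>R u + s' *\<^sub>R u' = (s + s') *\<^sub>R u''"
    proof (cases "s + s' = 0")
      case True
      then have "s = 0" "s' = 0" using ts by auto
      then show ?thesis using that u by simp
    next
      case False
      then have T: "0 < s + s'" using ts by simp
      have "(s / (s + s')) *\<^sub>R u + (s' / (s + s')) *\<^sub>R u' \<in> V"
        by (rule convexD[OF V(4) u]) (use ts T in \<open>auto simp flip: add_divide_distrib\<close>)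
      then show ?thesis using that T by (fastforce simp: scaleR_add_right)
    qed
    have vw': "v + w = (t + t') *\<^sub>R z'' + (s + s') *\<^sub>R u''"
      unfolding vw z''(1)[symmetric] u''(2)[symmetric] by simp
    have "(t + t') * (f (a + z'') - c) + (s + s') * K \<le> x + y"
      unfolding xy using z''(2) by (simp add: algebra_simps)
    then show "\<exists>q\<in>S (v + w). q \<le> x + y"
      using SI[of "t + t'" "s + s'" u'' z''] ts u''(1) unfolding vw' by auto
  next
    fix v x and r :: real assume "x \<in> S v" "0 < r"
    then obtain t z s u where ts: "0 \<le> t" "0 \<le> s" and u: "u \<in> V"
      and v: "v = t *\<^sub>R z + s *\<^sub>R u" and x: "x = t * (f (a + z) - c) + s * K"
      unfolding S_def by auto
    show "r * x \<in> S (r *\<^sub>R v)"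
      using SI[of "r * t" "r * s" u z] ts u \<open>0 < r\<close> unfolding v x
      by (simp add: scaleR_add_right distrib_left mult.assoc)
  qed
  then have p: "sublinear p" "\<And>x w. x \<in> S w \<Longrightarrow> p w \<le> x" by auto
  obtain h where h: "linear h" "\<And>v. h v \<le> p v"
    using hahn_banach_sublinear[OF p(1)] by blast
  \<comment> \<open>The decomposition with \<open>t = 0\<close>, \<open>s = 1\<close> bounds
    \<open>h\<close> on \<open>V\<close>; the one with \<open>t = 1\<close>, \<open>s = 0\<close>
    gives the minorant property.\<close>
  have "h v \<le> K" if "v \<in> V" for v
    using h(2)[of v] p(2)[of K v] SI[of 0 1 v 0] that by auto
  then have "continuous_on UNIV h"
    using linear_bounded_above_imp_continuous[OF h(1) V(1,2) sym] by blast
  moreover have "c + h (x - a) \<le> f x" for x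
    using h(2)[of "x - a"] p(2)[of "f x - c" "x - a"] SI[of 1 0 0 "x - a"] V(2) by auto
  ultimately show ?thesis using that h(1) by blast
qed


section \<open>A minimax theorem for functions convex in the sense of Fan\<close>

text \<open>Separation in the plane: the points strictly above some \<open>(F l u, F l v)\<close>
  form a set \<open>V\<close>, convex by Fan convexity. If \<open>(c, c)\<close> is not in
  \<open>V\<close>, a separating line has a nonnegative normal \<open>(p, q)\<close>, and its
  normalized coordinates define a mean of \<open>u\<close> and \<open>v\<close> at which
  \<open>below\<close> fails.\<close>

lemma fan_minimax_two:
  fixes F :: "'l \<Rightarrow> 'u::real_vector \<Rightarrow> real"
  assumes fan: "\<And>l1 l2 s t. l1 \<in> L \<Longrightarrow> l2 \<in> L \<Longrightarrow> 0 \<le> s \<Longrightarrow> 0 \<le> t \<Longrightarrow> s + t = 1 \<Longrightarrow>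
      \<exists>l\<in>L. \<forall>u\<in>U. F l u \<le> s * F l1 u + t * F l2 u"
    and conc: "\<And>l. l \<in> L \<Longrightarrow> concave_on U (F l)"
    and below: "\<And>u. u \<in> U \<Longrightarrow> \<exists>l\<in>L. F l u < c"
    and u: "u \<in> U" and v: "v \<in> U"
  shows "\<exists>l\<in>L. F l u < c \<and> F l v < c"
proof (rule ccontr)
  assume contr: "\<not> ?thesis"
  define V where "V = {(x, y). \<exists>l\<in>L. F l u < x \<and> F l v < y}"
  have VI: "(x, y) \<in> V" if "l \<in> L" "F l u < x" "F l v < y" for l x y
    unfolding V_def using that by auto
  obtain l0 where l0: "l0 \<in> L" using below[OF u] by blast
  have "convex V"
  proof (rule convexI)
    fix w w' and s t :: real
    assume "w \<in> V" "w' \<in> V" and st: "0 \<le> s" "0 \<le> t" "s + t = 1"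
    then obtain x y l x' y' l' where w: "w = (x, y)" "w' = (x', y')"
      and l: "l \<in> L" "F l u < x" "F l v < y" "l' \<in> L" "F l' u < x'" "F l' v < y'"
      unfolding V_def by auto
    have lt: "s * p + t * q < s * p' + t * q'" if "p < p'" "q < q'" for p q p' q'
      using that st by (smt (verit) mult_less_cancel_left_disj mult_left_mono)
    from fan[OF l(1,4) st] obtain k where "k \<in> L"
      "F k u \<le> s * F l u + t * F l' u" "F k v \<le> s * F l v + t * F l' v" using u v by blast
    with lt[OF l(2,5)] lt[OF l(3,6)] show "s *\<^sub>R w + t *\<^sub>R w' \<in> V"
      unfolding w by (auto intro: VI)
  qed
  moreover have "V \<noteq> {}" using VI[OF l0, of "F l0 u + 1" "F l0 v + 1"] by auto
  moreover have "{(c, c)} \<inter> V = {}" using contr unfolding V_def by auto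
  ultimately obtain a d where a: "a \<noteq> 0" "inner a (c, c) \<le> d" and sep: "\<And>w. w \<in> V \<Longrightarrow> d \<le> inner a w"
    using separating_hyperplane_sets[of "{(c, c)}" V] by (metis convex_singleton insert_not_empty singletonI)
  obtain p q where pq: "a = (p, q)" by (cases a)
  have sep': "d \<le> p * x + q * y" if "l \<in> L" "F l u < x" "F l v < y" for l x y
    using sep[OF VI[OF that]] unfolding pq by simp
  \<comment> \<open>\<open>V\<close> is unbounded upwards, so a negative \<open>p\<close> could push
    the functional below \<open>d\<close>. The shift \<open>(e + 1) / (- p)\<close> is chosen to
    land exactly on \<open>d - 1\<close>.\<close>
  have "0 \<le> p"
  proof (rule ccontr)
    assume "\<not> 0 \<le> p"
    define e where "e = p * (F l0 u + 1) + q * (F l0 v + 1) - d"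
    have "0 \<le> e" unfolding e_def using sep'[OF l0] by simp
    have r: "0 < (e + 1) / (- p)" using \<open>\<not> 0 \<le> p\<close> \<open>0 \<le> e\<close> by (intro divide_pos_pos) auto
    have "d \<le> p * (F l0 u + 1 + (e + 1) / (- p)) + q * (F l0 v + 1)"
      by (rule sep'[OF l0]) (use r in auto)
    also have "\<dots> = e + d - (e + 1)" unfolding e_def using \<open>\<not> 0 \<le> p\<close> by (simp add: field_simps)
    finally show False by simp
  qed
  have "0 \<le> q"
  proof (rule ccontr)
    assume "\<not> 0 \<le> q"
    define e where "e = p * (F l0 u + 1) + q * (F l0 v + 1) - d"
    have "0 \<le> e" unfolding e_def using sep'[OF l0] by simp
    have r: "0 < (e + 1) / (- q)" using \<open>\<not> 0 \<le> q\<close> \<open>0 \<le> e\<close> by (intro divide_pos_pos) auto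
    have "d \<le> p * (F l0 u + 1) + q * (F l0 v + 1 + (e + 1) / (- q))"
      by (rule sep'[OF l0]) (use r in auto)
    also have "\<dots> = e + d - (e + 1)" unfolding e_def using \<open>\<not> 0 \<le> q\<close> by (simp add: field_simps)
    finally show False by simp
  qed
  have P: "0 < p + q" using \<open>0 \<le> p\<close> \<open>0 \<le> q\<close> a(1) unfolding pq by (auto simp: zero_prod_def)
  \<comment> \<open>Concavity at this point turns \<open>F l w < c\<close> into an upper bound for
    \<open>p * F l u + q * F l v\<close>, against the separation.\<close>
  define w where "w = (p / (p + q)) *\<^sub>R u + (q / (p + q)) *\<^sub>R v"
  have weights: "0 \<le> p / (p + q)" "0 \<le> q / (p + q)" "p / (p + q) + q / (p + q) = 1"
    using P \<open>0 \<le> p\<close> \<open>0 \<le> q\<close> by (auto simp flip: add_divide_distrib)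
  have "w \<in> U" unfolding w_def
    using conc[OF l0] u v weights by (auto simp: concave_on_iff convex_def)
  then obtain l where l: "l \<in> L" "F l w < c" using below by blast
  have "(p / (p + q)) * F l u + (q / (p + q)) * F l v \<le> F l w"
    unfolding w_def using conc[OF l(1)] u v weights unfolding concave_on_iff by blast
  then have "(p + q) * ((p / (p + q)) * F l u + (q / (p + q)) * F l v) \<le> (p + q) * F l w"
    using P by (intro mult_left_mono) auto
  then have 1: "p * F l u + q * F l v \<le> (p + q) * F l w"
    using P by (simp add: distrib_left)
  \<comment> \<open>Half the gap: membership in \<open>V\<close> needs strict inequalities, while
    \<open>F l w + e\<close> must remain below \<open>c\<close>.\<close>
  define e where "e = (c - F l w) / 2"
  have "0 < e" unfolding e_def using l by simp
  then have "d \<le> p * (F l u + e) + q * (F l v + e)" by (intro sep'[OF l(1)]) auto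
  moreover have "(p + q) * c \<le> d" using a(2) unfolding pq by (simp add: algebra_simps)
  ultimately have "(p + q) * c \<le> (p + q) * (F l w + e)" using 1 by (simp add: algebra_simps)
  then have "c \<le> F l w + e" using P by simp
  then show False using l(2) unfolding e_def by (simp add: field_simps)
qed

text \<open>The induction adds a point \<open>v\<close> by shrinking \<open>L\<close> to
  \<open>{l \<in> L. F l v < c}\<close>. Fan convexity survives, since a convex combination of
  values below \<open>c\<close> is below \<open>c\<close>, and \<open>below\<close> survives by the
  two-point case.\<close>

lemma fan_minimax_finite:
  fixes F :: "'l \<Rightarrow> 'u::real_vector \<Rightarrow> real"
  assumes "finite S" and "S \<subseteq> U" and "U \<noteq> {}"
    and fan: "\<And>l1 l2 s t. l1 \<in> L \<Longrightarrow> l2 \<in> L \<Longrightarrow> 0 \<le> s \<Longrightarrow> 0 \<le> t \<Longrightarrow> s + t = 1 \<Longrightarrow>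
      \<exists>l\<in>L. \<forall>u\<in>U. F l u \<le> s * F l1 u + t * F l2 u"
    and conc: "\<And>l. l \<in> L \<Longrightarrow> concave_on U (F l)"
    and below: "\<And>u. u \<in> U \<Longrightarrow> \<exists>l\<in>L. F l u < c"
  shows "\<exists>l\<in>L. \<forall>u\<in>S. F l u < c"
  using assms
proof (induction S arbitrary: L rule: finite_induct)
  case empty
  then show ?case by blast
next
  case (insert v S)
  note fan = insert.prems(3) and conc = insert.prems(4) and below = insert.prems(5)
  have v: "v \<in> U" using insert.prems by simp
  have "\<exists>l\<in>{l \<in> L. F l v < c}. \<forall>u\<in>S. F l u < c"
  proof (rule insert.IH)
    fix l1 l2 and s t :: real
    assume l: "l1 \<in> {l \<in> L. F l v < c}" "l2 \<in> {l \<in> L. F l v < c}" and st: "0 \<le> s" "0 \<le> t" "s + t = 1"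
    then obtain l where "l \<in> L" and le: "\<forall>u\<in>U. F l u \<le> s * F l1 u + t * F l2 u"
      using fan[of l1 l2 s t] by auto
    have "F l v \<le> s * F l1 v + t * F l2 v" using le v by blast
    also have "\<dots> < c" using l st convex_bound_lt[of "F l1 v" c "F l2 v" s t] by auto
    finally show "\<exists>l\<in>{l \<in> L. F l v < c}. \<forall>u\<in>U. F l u \<le> s * F l1 u + t * F l2 u"
      using \<open>l \<in> L\<close> le by blast
  next
    fix u assume "u \<in> U"
    then have "\<exists>l\<in>L. F l u < c \<and> F l v < c"
      using fan_minimax_two[of L U F c u v] fan conc below v by blast
    then show "\<exists>l\<in>{l \<in> L. F l v < c}. F l u < c" by blast
  qed (use insert.prems in auto)
  then show ?case by blast
qed

text \<open>The finite case gives the finite intersection property for the closed sublevel sets;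
  compactness supplies a common index, with the weak inequality only.\<close>

theorem fan_minimax:
  fixes F :: "'l::topological_space \<Rightarrow> 'u::real_vector \<Rightarrow> real"
  assumes "compact (UNIV :: 'l set)" and "U \<noteq> {}"
    and closed: "\<And>u. u \<in> U \<Longrightarrow> closed {l. F l u \<le> c}"
    and fan: "\<And>l1 l2 s t. 0 \<le> s \<Longrightarrow> 0 \<le> t \<Longrightarrow> s + t = 1 \<Longrightarrow>
      \<exists>l. \<forall>u\<in>U. F l u \<le> s * F l1 u + t * F l2 u"
    and conc: "\<And>l. concave_on U (F l)"
    and below: "\<And>u. u \<in> U \<Longrightarrow> \<exists>l. F l u < c"
  shows "\<exists>l. \<forall>u\<in>U. F l u \<le> c"
proof -
  have "UNIV \<inter> (\<Inter>u\<in>U. {l. F l u \<le> c}) \<noteq> {}"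
  proof (rule compact_imp_fip_image[OF assms(1) closed])
    fix S assume "finite S" "S \<subseteq> U"
    then have "\<exists>l\<in>UNIV. \<forall>u\<in>S. F l u < c"
      by (rule fan_minimax_finite) (use assms in auto)
    then show "UNIV \<inter> (\<Inter>u\<in>S. {l. F l u \<le> c}) \<noteq> {}"
      by (auto intro: less_imp_le)
  qed
  then show ?thesis by auto
qed

section \<open>Families of conjugate pairs\<close>

text \<open>Since the functionals \<open>pair _ u\<close> need not be continuous, biconjugation is stated with the
  supremum over the continuous ones only; this restricted form is what makes the infimum
  over the family lower semicontinuous.\<close>

locale conjugate_family =
  fixes pair :: "'x::locally_convex_space \<Rightarrow> 'y::locally_convex_space \<Rightarrow> real"
    and f :: "'l::topological_space \<Rightarrow> 'x \<Rightarrow> real"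
    and g :: "'l \<Rightarrow> 'y \<Rightarrow> real"
  assumes bilinear: "bilinear pair"
    and compact: "compact (UNIV :: 'l set)"
    and f_cont: "\<And>x. continuous_on UNIV (\<lambda>l. f l x)"
    and g_cont: "\<And>y. continuous_on UNIV (\<lambda>l. g l y)"
    and f_convex: "\<And>l. convex_on UNIV (f l)"
    and g_convex: "\<And>l. convex_on UNIV (g l)"
    and young: "\<And>l x y. pair x y \<le> f l x + g l y"
    and f_sup: "\<And>c l x. c < f l x \<Longrightarrow> \<exists>u. continuous_on UNIV (\<lambda>z. pair z u) \<and> c < pair x u - g l u"
    and g_sup: "\<And>c l y. c < g l y \<Longrightarrow> \<exists>z. continuous_on UNIV (\<lambda>u. pair z u) \<and> c < pair z y - f l z"
    and f_fan: "\<And>x l1 l2 s t. 0 \<le> s \<Longrightarrow> 0 \<le> t \<Longrightarrow> s + t = 1 \<Longrightarrow>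
      \<exists>l. \<forall>z. f l x - f l z \<le> s * (f l1 x - f l1 z) + t * (f l2 x - f l2 z)"
    and g_fan: "\<And>y l1 l2 s t. 0 \<le> s \<Longrightarrow> 0 \<le> t \<Longrightarrow> s + t = 1 \<Longrightarrow>
      \<exists>l. \<forall>u. g l y - g l u \<le> s * (g l1 y - g l1 u) + t * (g l2 y - g l2 u)"
begin

text \<open>The assumptions are symmetric under exchanging \<open>f\<close> and \<open>g\<close>, so
  every fact on the first variable of \<open>b\<close> transfers to the second.\<close>

lemma flip: "conjugate_family (\<lambda>y x. pair x y) g f"
proof
  show "bilinear (\<lambda>y x. pair x y)" using bilinear unfolding bilinear_def by simp
  show "pair x y \<le> g l y + f l x" for l x y using young[of x y l] by simp
qed (fact compact f_cont g_cont f_convex g_convex f_sup g_sup f_fan g_fan)+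

definition b :: "'x \<Rightarrow> 'y \<Rightarrow> real" where
  "b x y = (INF l. f l x + g l y)"

lemma flip_b: "conjugate_family.b g f y x = b x y"
  unfolding b_def conjugate_family.b_def[OF flip] by (simp add: add.commute)

lemma b_le: "b x y \<le> f l x + g l y"
  unfolding b_def using young by (intro cINF_lower bdd_belowI2) auto

lemma pair_le_b: "pair x y \<le> b x y"
  unfolding b_def using young by (intro cINF_greatest) auto

lemma b_attained: obtains l where "b x y = f l x + g l y"
proof -
  have "continuous_on UNIV (\<lambda>l. f l x + g l y)"
    by (intro continuous_on_add f_cont g_cont)
  then obtain l where "\<And>k. f l x + g l y \<le> f k x + g k y"
    using continuous_attains_inf[OF compact] by blast
  then have "f l x + g l y \<le> b x y"
    unfolding b_def by (intro cINF_greatest) auto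
  with b_le[of x y l] that show ?thesis by simp
qed

text \<open>Let \<open>l1\<close>, \<open>l2\<close> attain \<open>b\<close> at the endpoints and
  let \<open>l\<close> come from Fan convexity of \<open>g\<close> at \<open>y\<close>. This
  \<open>l\<close> witnesses the bound at the intermediate point: \<open>f_sup\<close> tests it
  against single elements \<open>u\<close>.\<close>

lemma b_convex: "convex_on UNIV (\<lambda>x. b x y)"
proof -
  have "b (s *\<^sub>R x1 + t *\<^sub>R x2) y \<le> s * b x1 y + t * b x2 y"
    if st: "0 \<le> s" "0 \<le> t" "s + t = 1" for s t x1 x2
  proof -
    obtain l1 where l1: "b x1 y = f l1 x1 + g l1 y" by (rule b_attained)
    obtain l2 where l2: "b x2 y = f l2 x2 + g l2 y" by (rule b_attained)
    obtain l where l: "\<And>u. g l y - g l u \<le> s * (g l1 y - g l1 u) + t * (g l2 y - g l2 u)"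
      using g_fan[OF st] by blast
    let ?x = "s *\<^sub>R x1 + t *\<^sub>R x2"
    have "f l ?x \<le> s * b x1 y + t * b x2 y - g l y"
    proof (rule ccontr)
      assume "\<not> ?thesis"
      then obtain u where "s * b x1 y + t * b x2 y - g l y < pair ?x u - g l u"
        using f_sup[of "s * b x1 y + t * b x2 y - g l y" l ?x] by auto
      moreover have "pair ?x u = s * pair x1 u + t * pair x2 u"
        by (simp add: bilinear_ladd[OF bilinear] bilinear_lmul[OF bilinear])
      \<comment> \<open>Young's inequality at \<open>u\<close> for \<open>l1\<close> and
        \<open>l2\<close>, combined with the Fan inequality at \<open>u\<close>, contradicts the
        choice of \<open>u\<close>.\<close>
      moreover have "s * pair x1 u \<le> s * (f l1 x1 + g l1 u)" "t * pair x2 u \<le> t * (f l2 x2 + g l2 u)"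
        using young st by (auto intro: mult_left_mono)
      ultimately show False using l[of u] unfolding l1 l2 distrib_left right_diff_distrib by linarith
    qed
    then show ?thesis using b_le[of ?x y l] by simp
  qed
  then show ?thesis unfolding convex_on_def by simp
qed

text \<open>Were no single \<open>u\<close> good for all \<open>l\<close>, the minimax theorem would
  give one \<open>l\<close> with \<open>F l u \<le> c\<close> for all admissible \<open>u\<close>,
  so \<open>b x0 y \<le> f l x0 + g l y \<le> c\<close>.\<close>

lemma b_affine_minorant:
  assumes "c < b x0 y"
  obtains u where "continuous_on UNIV (\<lambda>x. pair x u)" "\<And>x. c + (pair x u - pair x0 u) \<le> b x y"
proof -
  define U where "U = {u. continuous_on UNIV (\<lambda>x. pair x u)}"
  \<comment> \<open>By \<open>young\<close> and \<open>f_sup\<close>, the supremum of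
    \<open>F l u\<close> over \<open>u \<in> U\<close> is \<open>f l x0 + g l y\<close>.\<close>
  define F where "F l u = pair x0 u - g l u + g l y" for l u
  have "\<exists>u\<in>U. \<forall>l. c \<le> F l u"
  proof (rule ccontr)
    assume "\<not> ?thesis"
    then have below: "\<exists>l. F l u < c" if "u \<in> U" for u
      using that by (auto simp: not_le)
    have "\<exists>l. \<forall>u\<in>U. F l u \<le> c"
    proof (rule fan_minimax[OF compact _ _ _ _ below])
      show "U \<noteq> {}" unfolding U_def by (auto simp: bilinear_rzero[OF bilinear] intro!: exI[of _ 0])
      show "closed {l. F l u \<le> c}" for u
        unfolding F_def by (intro closed_Collect_le continuous_intros g_cont)
      show "\<exists>l. \<forall>u\<in>U. F l u \<le> s * F l1 u + t * F l2 u"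
        if st: "0 \<le> s" "0 \<le> t" "s + t = 1" for l1 l2 s t
      proof -
        obtain l where l: "\<And>u. g l y - g l u \<le> s * (g l1 y - g l1 u) + t * (g l2 y - g l2 u)"
          using g_fan[OF st] by blast
        have "s * pair x0 u + t * pair x0 u = pair x0 u" for u
          using st by (simp flip: distrib_right)
        then have "F l u \<le> s * F l1 u + t * F l2 u" for u
          using l[of u] unfolding F_def by (simp add: algebra_simps)
        then show ?thesis by blast
      qed
      show "concave_on U (F l)" for l
        unfolding concave_on_iff
      proof (intro conjI ballI allI impI)
        show "convex U" unfolding U_def convex_def
          by (auto simp: bilinear_radd[OF bilinear] bilinear_rmul[OF bilinear] intro!: continuous_on_add continuous_on_mult_left)
        fix u v and s t :: real assume st: "0 \<le> s" "0 \<le> t" "s + t = 1"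
        then have "g l (s *\<^sub>R u + t *\<^sub>R v) \<le> s * g l u + t * g l v"
          using g_convex unfolding convex_on_def by blast
        moreover have "s * g l y + t * g l y = g l y"
          using st by (simp flip: distrib_right)
        ultimately show "s * F l u + t * F l v \<le> F l (s *\<^sub>R u + t *\<^sub>R v)"
          unfolding F_def bilinear_radd[OF bilinear] bilinear_rmul[OF bilinear]
          by (simp add: algebra_simps)
      qed
    qed
    then obtain l where l: "\<And>u. u \<in> U \<Longrightarrow> F l u \<le> c" by blast
    have "f l x0 \<le> c - g l y"
    proof (rule ccontr)
      assume "\<not> ?thesis"
      then obtain u where "u \<in> U" "c - g l y < pair x0 u - g l u"
        using f_sup[of "c - g l y" l x0] unfolding U_def by auto
      then show False using l[of u] unfolding F_def by simp
    qed
    then show False using b_le[of x0 y l] assms by simp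
  qed
  then obtain u where u: "u \<in> U" "\<And>l. c \<le> F l u" by blast
  have "c + (pair x u - pair x0 u) \<le> b x y" for x
  proof -
    \<comment> \<open>For the index attaining \<open>b x y\<close>, add
      \<open>pair x u - g l u \<le> f l x\<close> to \<open>c \<le> F l u\<close>.\<close>
    obtain l where "b x y = f l x + g l y" by (rule b_attained)
    then show ?thesis using young[of x u l] u(2)[of l] unfolding F_def by simp
  qed
  with u(1) that show ?thesis unfolding U_def by blast
qed

lemma b_lsc: "open {x. c < b x y}"
proof (subst open_subopen, clarify)
  fix x0 assume "c < b x0 y"
  then obtain c' where c': "c < c'" "c' < b x0 y" using dense by blast
  obtain u where u: "continuous_on UNIV (\<lambda>x. pair x u)" "\<And>x. c' + (pair x u - pair x0 u) \<le> b x y"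
    using b_affine_minorant[OF c'(2)] by blast
  let ?T = "{x. c < c' + (pair x u - pair x0 u)}"
  have "open ?T" by (intro open_Collect_less continuous_intros u(1))
  moreover have "x0 \<in> ?T" using c'(1) by simp
  moreover have "?T \<subseteq> {x. c < b x y}" using u(2) by (auto intro: less_le_trans)
  ultimately show "\<exists>T. open T \<and> x0 \<in> T \<and> T \<subseteq> {x. c < b x y}" by blast
qed

lemma b_subgradient_iff: "(\<forall>z. pair (z - x) y \<le> b z y - b x y) \<longleftrightarrow> b x y = pair x y"
proof
  assume sub: "\<forall>z. pair (z - x) y \<le> b z y - b x y"
  have "b x y \<le> pair x y"
  proof (rule ccontr)
    assume less: "\<not> ?thesis"
    \<comment> \<open>Any index will do: by \<open>g_sup\<close>,
      \<open>f l z + g l y - pair z y\<close> takes values below every positive bound, here below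
      \<open>b x y - pair x y\<close>, which the subgradient inequality forbids.\<close>
    fix l
    obtain z where "g l y - (b x y - pair x y) < pair z y - f l z"
      using g_sup[of "g l y - (b x y - pair x y)" l y] less by auto
    then show False
      using sub[rule_format, of z] b_le[of z y l] by (simp add: bilinear_lsub[OF bilinear])
  qed
  then show "b x y = pair x y" using pair_le_b by (rule antisym)
next
  assume "b x y = pair x y"
  then show "\<forall>z. pair (z - x) y \<le> b z y - b x y"
    using pair_le_b by (simp add: bilinear_lsub[OF bilinear])
qed

end

section \<open>From extended-real covers to real conjugate pairs\<close>

lemma convex_lsc_ereal_iff:
  fixes h :: "'a::locally_convex_space \<Rightarrow> real"
  shows "convex_lsc (\<lambda>x. ereal (h x)) \<longleftrightarrow> convex_on UNIV h \<and> (\<forall>c. open {x. c < h x})"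
proof -
  have "lsc (\<lambda>x. ereal (h x)) \<longleftrightarrow> (\<forall>c. open {x. c < h x})"
  proof
    assume "lsc (\<lambda>x. ereal (h x))"
    then show "\<forall>c. open {x. c < h x}" unfolding lsc_def by (metis (mono_tags, lifting) Collect_cong less_ereal.simps(1))
  next
    assume op: "\<forall>c. open {x. c < h x}"
    show "lsc (\<lambda>x. ereal (h x))" unfolding lsc_def
    proof
      fix c show "open {x. c < ereal (h x)}" using op by (cases c) auto
    qed
  qed
  then show ?thesis
    unfolding convex_lsc_def ereal_convex_def convex_on_def by auto
qed

lemma fan_convex_ereal_diff_iff:
  "fan_convex (\<lambda>l z. ereal (p l) - ereal (q l z)) \<longleftrightarrow>
    (\<forall>l1 l2 s t. 0 \<le> s \<longrightarrow> 0 \<le> t \<longrightarrow> s + t = 1 \<longrightarrow>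
      (\<exists>l. \<forall>z. p l - q l z \<le> s * (p l1 - q l1 z) + t * (p l2 - q l2 z)))"
  unfolding fan_convex_def by (auto simp: Ball_def)

text \<open>Compatibility represents the linear part of a continuous affine minorant by the pairing;
  this yields the two restricted biconjugation properties \<open>f_sup\<close> and
  \<open>g_sup\<close>.\<close>

lemma conjugate_family_of_cover:
  fixes pair :: "'x::locally_convex_space \<Rightarrow> 'y::locally_convex_space \<Rightarrow> real"
    and f :: "'l::topological_space \<Rightarrow> 'x \<Rightarrow> real"
  assumes dual: "compatible_duality pair"
    and compact: "compact (UNIV :: 'l set)"
    and conj: "\<And>l. fenchel_conj pair (\<lambda>x. ereal (f l x)) = (\<lambda>y. ereal (g l y))"
    and f: "\<And>l. convex_lsc (\<lambda>x. ereal (f l x))" and g: "\<And>l. convex_lsc (\<lambda>y. ereal (g l y))"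
    and f_cont: "\<And>x. continuous_on UNIV (\<lambda>l. f l x)"
    and g_cont: "\<And>y. continuous_on UNIV (\<lambda>l. g l y)"
    and fan: "fan_bi_implicitly_convex pair (\<lambda>l x. ereal (f l x))"
  shows "conjugate_family pair f g"
proof -
  have bil: "bilinear pair" using dual unfolding compatible_duality_def by blast
  have sup: "(SUP x. ereal (pair x y - f l x)) = ereal (g l y)" for l y
    using conj[of l] unfolding fenchel_conj_def by (simp add: fun_eq_iff)
  have young: "pair x y - f l x \<le> g l y" for x y l
    using SUP_upper[of x UNIV "\<lambda>x. ereal (pair x y - f l x)"] unfolding sup by simp
  have conj_le: "g l y \<le> c" if "\<And>x. pair x y - f l x \<le> c" for l y c
    using SUP_least[of UNIV "\<lambda>x. ereal (pair x y - f l x)" "ereal c"] that unfolding sup by simp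
  have f': "convex_on UNIV (f l)" "open {x. c < f l x}"
    and g': "convex_on UNIV (g l)" "open {y. c < g l y}" for l c
    using f[of l] g[of l] unfolding convex_lsc_ereal_iff by auto
  have f_sup: "\<exists>u. continuous_on UNIV (\<lambda>z. pair z u) \<and> c < pair x u - g l u"
    if less: "c < f l x" for c l x
  proof -
    obtain c' where c': "c < c'" "c' < f l x" using less dense by blast
    obtain h where h: "linear h" "continuous_on UNIV h" "\<And>z. c' + h (z - x) \<le> f l z"
      using convex_lsc_affine_minorant[OF f'(1,2) c'(2)] by blast
    obtain u where u: "h = (\<lambda>z. pair z u)"
      using dual h(1,2) unfolding compatible_duality_def by blast
    have "g l u \<le> pair x u - c'"
      using h(3) unfolding u by (intro conj_le) (simp add: bilinear_lsub[OF bil] algebra_simps)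
    then show ?thesis using c'(1) h(2) unfolding u by (intro exI[of _ u]) auto
  qed
  have g_sup: "\<exists>z. continuous_on UNIV (\<lambda>u. pair z u) \<and> c < pair z y - f l z"
    if less: "c < g l y" for c l y
  proof -
    obtain c' where c': "c < c'" "c' < g l y" using less dense by blast
    obtain h where h: "linear h" "continuous_on UNIV h" "\<And>u. c' + h (u - y) \<le> g l u"
      using convex_lsc_affine_minorant[OF g'(1,2) c'(2)] by blast
    obtain z where z: "h = (\<lambda>u. pair z u)"
      using dual h(1,2) unfolding compatible_duality_def by blast
    \<comment> \<open>\<open>g l\<close> is the conjugate of \<open>f l\<close> by assumption, but
      the converse is not given; \<open>f_sup\<close> at \<open>z\<close> bridges this.\<close>
    have "f l z \<le> pair z y - c'"
    proof (rule ccontr)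
      assume "\<not> ?thesis"
      then obtain u where "pair z y - c' < pair z u - g l u"
        using f_sup[of "pair z y - c'" l z] by auto
      then show False using h(3)[of u] unfolding z by (simp add: bilinear_rsub[OF bil])
    qed
    then show ?thesis using c'(1) h(2) unfolding z by (intro exI[of _ z]) auto
  qed
  have fan': "\<And>x. fan_convex (\<lambda>l z. ereal (f l x) - ereal (f l z))"
    "\<And>y. fan_convex (\<lambda>l u. ereal (g l y) - ereal (g l u))"
    using fan unfolding fan_bi_implicitly_convex_def conj by blast+
  show ?thesis
  proof
    show "pair x y \<le> f l x + g l y" for l x y using young[of x y l] by simp
    show "\<exists>l. \<forall>z. f l x - f l z \<le> s * (f l1 x - f l1 z) + t * (f l2 x - f l2 z)"
      if "0 \<le> s" "0 \<le> t" "s + t = 1" for x l1 l2 s t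
      using fan'(1)[of x] that unfolding fan_convex_ereal_diff_iff by blast
    show "\<exists>l. \<forall>u. g l y - g l u \<le> s * (g l1 y - g l1 u) + t * (g l2 y - g l2 u)"
      if "0 \<le> s" "0 \<le> t" "s + t = 1" for y l1 l2 s t
      using fan'(2)[of y] that unfolding fan_convex_ereal_diff_iff by blast
  qed (fact bil compact f_cont g_cont f'(1) g'(1) f_sup g_sup)+
qed

theorem theorem12p4:
  fixes pair :: "'x::locally_convex_space \<Rightarrow> 'y::locally_convex_space \<Rightarrow> real"
    and \<phi> :: "'l::t2_space \<Rightarrow> 'x \<Rightarrow> ereal"
    and M :: "('x \<times> 'y) set"
    and b :: "'x \<Rightarrow> 'y \<Rightarrow> ereal"
  assumes "compatible_duality pair"
    and "BB_graph M"
    and "convex_lagrangian_cover pair \<phi> M"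
    and "\<And>l. \<phi> l \<in> Gamma_fin"
    and "\<And>l. fenchel_conj pair (\<phi> l) \<in> Gamma_fin"
    and "\<And>x. continuous_on UNIV (\<lambda>l. \<phi> l x)"
    and "\<And>y. continuous_on UNIV (\<lambda>l. fenchel_conj pair (\<phi> l) y)"
    and "fan_bi_implicitly_convex pair \<phi>"
    and "\<And>x y. b x y = (INF l. \<phi> l x + fenchel_conj pair (\<phi> l) y)"
  shows "(\<forall>x y. \<bar>b x y\<bar> \<noteq> \<infinity>) \<and> bipotential pair b \<and> M = bipotential_graph pair b"
proof -
  define f where "f l x = real_of_ereal (\<phi> l x)" for l x
  define g where "g l y = real_of_ereal (fenchel_conj pair (\<phi> l) y)" for l y
  have \<phi>: "\<phi> = (\<lambda>l x. ereal (f l x))"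
    using assms(4) unfolding Gamma_fin_def f_def by (simp add: fun_eq_iff ereal_real)
  have conj: "fenchel_conj pair (\<lambda>x. ereal (f l x)) = (\<lambda>y. ereal (g l y))" for l
    using assms(5)[of l] unfolding Gamma_fin_def g_def
    by (simp add: fun_eq_iff ereal_real flip: fun_cong[OF \<phi>])
  have M: "compact (UNIV :: 'l set)" "M = (\<Union>l. fenchel_graph pair (\<phi> l))"
    using assms(3) unfolding convex_lagrangian_cover_def by auto
  interpret F: conjugate_family pair f g
  proof (rule conjugate_family_of_cover[OF assms(1) M(1) conj])
    show "convex_lsc (\<lambda>x. ereal (f l x))" for l
      using assms(4)[of l] unfolding Gamma_fin_def \<phi> by simp
    show "convex_lsc (\<lambda>y. ereal (g l y))" for l
      using assms(5)[of l] unfolding Gamma_fin_def \<phi> conj by simp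
    show "continuous_on UNIV (\<lambda>l. f l x)" for x
      using assms(6)[of x] unfolding \<phi> by (simp add: continuous_on_iff_real o_def)
    show "continuous_on UNIV (\<lambda>l. g l y)" for y
      using assms(7)[of y] unfolding \<phi> conj by (simp add: continuous_on_iff_real o_def)
    show "fan_bi_implicitly_convex pair (\<lambda>l x. ereal (f l x))"
      using assms(8) unfolding \<phi> .
  qed
  interpret G: conjugate_family "\<lambda>y x. pair x y" g f by (rule F.flip)
  have b: "b = (\<lambda>x y. ereal (F.b x y))"
  proof (intro ext)
    fix x y
    obtain l where l: "F.b x y = f l x + g l y" by (rule F.b_attained)
    have "(INF l. ereal (f l x + g l y)) = ereal (F.b x y)"
    proof (rule antisym)
      show "(INF l. ereal (f l x + g l y)) \<le> ereal (F.b x y)"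
        unfolding l by (rule INF_lower) simp
      show "ereal (F.b x y) \<le> (INF l. ereal (f l x + g l y))"
        using F.b_le by (intro INF_greatest) simp
    qed
    then show "b x y = ereal (F.b x y)" unfolding assms(9) unfolding \<phi> conj by simp
  qed
  have sub1: "y \<in> subdiff pair (\<lambda>z. b z y) x \<longleftrightarrow> F.b x y = pair x y" for x y
    unfolding subdiff_def b using F.b_subgradient_iff[of x y] by simp
  have sub2: "x \<in> subdiff (\<lambda>u z. pair z u) (\<lambda>u. b x u) y \<longleftrightarrow> F.b x y = pair x y" for x y
    unfolding subdiff_def b using G.b_subgradient_iff[where x = y and y = x] by (simp add: F.flip_b)
  have "convex_lsc (\<lambda>x. b x y)" for y
    unfolding b convex_lsc_ereal_iff using F.b_convex F.b_lsc by blast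
  moreover have "convex_lsc (\<lambda>y. b x y)" for x
    unfolding b convex_lsc_ereal_iff using G.b_convex[of x] G.b_lsc[of _ x] by (simp add: F.flip_b)
  ultimately have "bipotential pair b"
    unfolding bipotential_def sub1 sub2 by (simp add: b F.pair_le_b)
  moreover have "M = bipotential_graph pair b"
  proof -
    \<comment> \<open>Every member of the infimum is at least \<open>b x y\<close>, hence at least
      \<open>pair x y\<close>, so equality for one index forces equality for \<open>b\<close>;
      conversely the infimum is attained.\<close>
    have "(\<exists>l. f l x + g l y = pair x y) \<longleftrightarrow> F.b x y = pair x y" for x y
      using F.b_le[of x y] F.pair_le_b[of x y] F.b_attained[of x y] by (metis antisym)
    then show ?thesis
      unfolding M(2) fenchel_graph_def bipotential_graph_def b \<phi> conj by auto
  qed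
  ultimately show ?thesis unfolding b by simp
qed

end
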